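(* Let $n>m\ge1$, let $A$ be a real $(m\times n)$-matrix of full rank $m$, let $\kappa$ be the condition number of $A$, and let $\xi=\sqrt{m/n}$. If $\delta\ge 0$ and $\kappa\delta<\xi$, then for all radii $R>0$ $$\frac{\lambda\big(\{x\in\mathbb{R}^n\mid \|Ax\|<\delta\,\|A\|\,\|x\|,\ \|x\|\le R\}\big)}{\lambda\big(\{x\in\mathbb{R}^n\mid\|x\|\le R\}\big)}\le\phi\bigg(\frac{\kappa\delta}{\xi}\bigg)^m .$$
   Context: $\|x\|$ and $\|Ax\|$ are Euclidean norms, $\|A\|$ is the spectral norm, and $\lambda$ is the volume (Lebesgue) measure on $\mathbb{R}^n$. The condition number $\kappa$ of $A$ is the ratio of its maximum to its minimum singular value, where the singular values are the $m$ numbers $\sigma_1\le\dots\le\sigma_m$, so $\kappa=\sigma_m/\sigma_1$. The function $\phi$ is $$\phi(\vartheta)=\vartheta\,\exp\bigg(\frac{1-\vartheta^2}{2}\bigg).$$ *)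

theory Defs
  imports "HOL-Analysis.Analysis"
begin

(* The singular values of an (m x n)-matrix with m <= n are the square roots of the
   eigenvalues of the (m x m)-matrix A A^T. They are collected as a set, so multiplicities
   are not recorded; the largest and the smallest one do not depend on them.
   For m > n the set below always contains 0. *)
definition singular_values :: "real^'n^'m \<Rightarrow> real set" where
  "singular_values A =
     {\<sigma>. \<sigma> \<ge> 0 \<and> (\<exists>v. v \<noteq> 0 \<and> (A ** transpose A) *v v = \<sigma>\<^sup>2 *\<^sub>R v)}"

definition condition_number :: "real^'n^'m \<Rightarrow> real" where
  "condition_number A = Max (singular_values A) / Min (singular_values A)"

definition spectral_norm :: "real^'n^'m \<Rightarrow> real" where
  "spectral_norm A = onorm ((*v) A)"

definition phi :: "real \<Rightarrow> real" where
  "phi \<theta> = \<theta> * exp ((1 - \<theta>\<^sup>2) / 2)"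

end

theory Submission
  imports Defs
begin

text \<open>
  Write \<open>\<sigma>\<^sub>1\<close> and \<open>\<sigma>\<^sub>m\<close> for the extreme singular values, \<open>t = \<kappa> \<delta>\<close>, and let \<open>P\<close> be the
  orthogonal projection onto the row space \<open>V\<close> of \<open>A\<close>, which has dimension \<open>m\<close>. Since
  \<open>\<parallel>A x\<parallel> \<ge> \<sigma>\<^sub>1 \<parallel>P x\<parallel>\<close> and \<open>\<parallel>A\<parallel> \<le> \<sigma>\<^sub>m\<close>, every point of the set \<open>C\<close> in the numerator satisfies
  \<open>\<parallel>P x\<parallel> \<le> t \<parallel>x\<parallel>\<close>: it lies in a cone around the orthogonal complement of \<open>V\<close>
  (\<open>norm_lower_bound_on_row_space\<close>, \<open>spectral_norm_le_Max\<close>).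

  Points of this cone are short in the directions of \<open>V\<close>, so one can stretch these directions by
  a factor \<open>a\<close> and compress the complementary ones by \<open>b\<close> without leaving the ball. The
  squared length of the image of \<open>x\<close> is \<open>b\<^sup>2 \<parallel>x\<parallel>\<^sup>2 + (a\<^sup>2 - b\<^sup>2) \<parallel>P x\<parallel>\<^sup>2\<close>, which is at most
  \<open>\<parallel>x\<parallel>\<^sup>2\<close> on the cone as soon as \<open>b \<le> a\<close> and \<open>a\<^sup>2 t\<^sup>2 + b\<^sup>2 (1 - t\<^sup>2) = 1\<close>. The map multiplies volumes by
  \<open>a\<^sup>m b\<^sup>n\<^sup>-\<^sup>m\<close>, so \<open>C\<close> fills at most the fraction \<open>1 / (a\<^sup>m b\<^sup>n\<^sup>-\<^sup>m)\<close> of the ball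
  (\<open>volume_cone_near_complement_le\<close>).

  The product \<open>a\<^sup>m b\<^sup>n\<^sup>-\<^sup>m\<close> is largest under this constraint for \<open>a = \<xi> / t\<close> and
  \<open>b\<^sup>2 = (1 - \<xi>\<^sup>2) / (1 - t\<^sup>2)\<close>. The inequality \<open>1 + u \<le> exp u\<close>, applied to \<open>1 / b\<^sup>2\<close>,
  turns the fraction into the power of \<open>\<phi>\<close>
  (\<open>reciprocal_stretch_le_phi_power\<close>).
\<close>

section \<open>Extreme singular values\<close>

text \<open>
  The form of \<open>f - c\<close> is nonnegative and vanishes at \<open>w\<close>. Moving from \<open>w\<close> in the direction of
  its gradient \<open>h = f w - c w\<close> would make it negative unless \<open>h = 0\<close>.
\<close>

lemma eigenvector_if_form_minimal:
  fixes f :: "'a::real_inner \<Rightarrow> 'a"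
  assumes "linear f" and sym: "\<And>x y. f x \<bullet> y = x \<bullet> f y"
    and le: "\<And>x. c * (x \<bullet> x) \<le> x \<bullet> f x"
    and eq: "w \<bullet> f w = c * (w \<bullet> w)"
  shows "f w = c *\<^sub>R w"
proof -
  define h where "h = f w - c *\<^sub>R w"
  define q where "q = h \<bullet> f h - c * (h \<bullet> h)"
  have q0: "q \<ge> 0" using le[of h] by (simp add: q_def)
  have main: "0 \<le> 2 * s * (h \<bullet> h) + s\<^sup>2 * q" for s
  proof -
    have "0 \<le> (w + s *\<^sub>R h) \<bullet> f (w + s *\<^sub>R h) - c * ((w + s *\<^sub>R h) \<bullet> (w + s *\<^sub>R h))"
      using le[of "w + s *\<^sub>R h"] by simp
    also have "\<dots> = 2 * s * (h \<bullet> (f w - c *\<^sub>R w)) + s\<^sup>2 * q"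
      using sym[of w h] eq
      by (simp add: linear_add[OF assms(1)] linear_scale[OF assms(1)] inner_add_left
          inner_add_right inner_diff_right q_def power2_eq_square algebra_simps inner_commute)
    finally show ?thesis by (simp add: h_def)
  qed
  have "h \<bullet> h = 0"
  proof (rule ccontr)
    assume "h \<bullet> h \<noteq> 0"
    then have pos: "h \<bullet> h > 0" by (simp add: order_less_le)
    \<comment> \<open>Any small negative step works; \<open>q + 1\<close> instead of \<open>q\<close> keeps the denominator positive.\<close>
    define s where "s = - (h \<bullet> h) / (q + 1)"
    have "2 * s * (h \<bullet> h) + s\<^sup>2 * q = - ((h \<bullet> h)\<^sup>2 * (q + 2)) / (q + 1)\<^sup>2"
      using q0 by (simp add: s_def power2_eq_square divide_simps) (simp add: algebra_simps)
    also have "\<dots> < 0" using pos q0 by (intro divide_neg_pos) auto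
    finally show False using main[of s] by simp
  qed
  then show ?thesis by (simp add: h_def)
qed

text \<open>
  Eigenvectors of the symmetric matrix \<open>A A\<^sup>T\<close> for distinct eigenvalues are orthogonal, hence
  independent. Finiteness is what makes \<open>Max\<close> and \<open>Min\<close> of the set of singular values meaningful.
\<close>

lemma finite_singular_values: "finite (singular_values (A :: real^'n^'m))"
proof -
  define M where "M = A ** transpose A"
  have sym: "(M *v x) \<bullet> y = x \<bullet> (M *v y)" for x y
    by (metis M_def dot_lmul_matrix matrix_transpose_mul transpose_transpose vector_transpose_matrix)
  define e where "e \<sigma> = (SOME v. v \<noteq> 0 \<and> M *v v = \<sigma>\<^sup>2 *\<^sub>R v)" for \<sigma> :: real
  have e: "e \<sigma> \<noteq> 0" "M *v e \<sigma> = \<sigma>\<^sup>2 *\<^sub>R e \<sigma>" if "\<sigma> \<in> singular_values A" for \<sigma>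
    using that someI_ex[of "\<lambda>v. v \<noteq> 0 \<and> M *v v = \<sigma>\<^sup>2 *\<^sub>R v"]
    by (auto simp: singular_values_def e_def M_def)
  have orth: "e \<sigma> \<bullet> e \<tau> = 0"
    if "\<sigma> \<in> singular_values A" "\<tau> \<in> singular_values A" "\<sigma> \<noteq> \<tau>" for \<sigma> \<tau>
  proof -
    have "\<sigma>\<^sup>2 \<noteq> \<tau>\<^sup>2" using that by (auto simp: singular_values_def)
    moreover have "\<sigma>\<^sup>2 * (e \<sigma> \<bullet> e \<tau>) = \<tau>\<^sup>2 * (e \<sigma> \<bullet> e \<tau>)"
      using sym[of "e \<sigma>" "e \<tau>"] e that by simp
    ultimately show ?thesis by simp
  qed
  have "inj_on e (singular_values A)"
    using orth e by (metis inj_onI inner_eq_zero_iff)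
  moreover have "independent (e ` singular_values A)"
    by (rule pairwise_orthogonal_independent)
       (use orth e in \<open>auto simp: pairwise_def orthogonal_def\<close>)
  ultimately show ?thesis
    using finite_imageD independent_imp_finite by blast
qed

text \<open>
  By compactness \<open>\<parallel>A\<^sup>T w\<parallel>\<close> attains its extrema on the unit sphere. Its square is the quadratic form of
  \<open>A A\<^sup>T\<close>, so the extremal points are eigenvectors and the extreme values are singular values.
\<close>

lemma transpose_norm_bounds:
  fixes A :: "real^'n^'m"
  shows Min_singular_value_le: "Min (singular_values A) * norm w \<le> norm (transpose A *v w)"
    and le_Max_singular_value: "norm (transpose A *v w) \<le> Max (singular_values A) * norm w"
    and singular_values_nonempty: "singular_values A \<noteq> {}"
proof -
  define M where "M = A ** transpose A"
  define g where "g w = norm (transpose A *v w)" for w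
  have sym: "(M *v x) \<bullet> y = x \<bullet> (M *v y)" for x y
    by (metis M_def dot_lmul_matrix matrix_transpose_mul transpose_transpose vector_transpose_matrix)
  have form: "x \<bullet> (M *v x) = (g x)\<^sup>2" for x
    unfolding g_def M_def power2_norm_eq_inner
    by (metis dot_lmul_matrix matrix_vector_mul_assoc vector_transpose_matrix inner_commute transpose_transpose)
  have scale: "g (c *\<^sub>R x) = \<bar>c\<bar> * g x" for c x
    unfolding g_def by (metis matrix_vector_mult_scaleR norm_scaleR)
  have cont: "continuous_on (sphere 0 1) g"
    unfolding g_def by (intro continuous_on_norm matrix_vector_mult_linear_continuous_on)
  have ne: "sphere (0::real^'m) 1 \<noteq> {}" by simp
  have normalise: "g x = norm x * g (x /\<^sub>R norm x)" "x \<noteq> 0 \<Longrightarrow> x /\<^sub>R norm x \<in> sphere 0 1" for x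
    by (cases "x = 0") (auto simp: scale, simp add: g_def)
  obtain u where u: "norm u = 1" "\<And>x. norm x = 1 \<Longrightarrow> g u \<le> g x"
    using continuous_attains_inf[OF compact_sphere ne cont] by auto
  obtain v where v: "norm v = 1" "\<And>x. norm x = 1 \<Longrightarrow> g x \<le> g v"
    using continuous_attains_sup[OF compact_sphere ne cont] by auto
  have lower: "g u * norm x \<le> g x" for x
    using normalise[of x] u(2)[of "x /\<^sub>R norm x"]
    by (cases "x = 0") (auto simp: mult.commute intro: mult_left_mono)
  have upper: "g x \<le> g v * norm x" for x
    using normalise[of x] v(2)[of "x /\<^sub>R norm x"]
    by (cases "x = 0") (auto simp: mult.commute intro: mult_left_mono)
  have "M *v u = (g u)\<^sup>2 *\<^sub>R u"
  proof (rule eigenvector_if_form_minimal[where f = "(*v) M"])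
    show "(g u)\<^sup>2 * (x \<bullet> x) \<le> x \<bullet> (M *v x)" for x
      using power_mono[OF lower[of x], of 2]
      by (simp add: form power_mult_distrib power2_norm_eq_inner g_def)
    show "u \<bullet> (M *v u) = (g u)\<^sup>2 * (u \<bullet> u)"
      using u(1) by (simp add: form norm_eq_1)
  qed (use sym in auto)
  then have inu: "g u \<in> singular_values A"
    using u(1) by (auto simp: singular_values_def M_def g_def intro!: exI[of _ u])
  \<comment> \<open>A maximum of the form of \<open>M\<close> is a minimum of the form of \<open>- M\<close>.\<close>
  have "- (M *v v) = (- (g v)\<^sup>2) *\<^sub>R v"
  proof (rule eigenvector_if_form_minimal[where f = "\<lambda>x. - (M *v x)"])
    show "- (g v)\<^sup>2 * (x \<bullet> x) \<le> x \<bullet> - (M *v x)" for x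
      using power_mono[OF upper[of x], of 2]
      by (simp add: form power_mult_distrib power2_norm_eq_inner g_def)
    show "v \<bullet> - (M *v v) = - (g v)\<^sup>2 * (v \<bullet> v)"
      using v(1) by (simp add: form norm_eq_1)
  qed (use sym in \<open>auto intro: linear_compose_neg\<close>)
  then have inv: "g v \<in> singular_values A"
    using v(1) by (auto simp: singular_values_def M_def g_def intro!: exI[of _ v])
  show "singular_values A \<noteq> {}" using inu by auto
  have "Min (singular_values A) \<le> g u" "g v \<le> Max (singular_values A)"
    using Min_le[OF finite_singular_values inu] Max_ge[OF finite_singular_values inv] by auto
  then show "Min (singular_values A) * norm w \<le> norm (transpose A *v w)"
    and "norm (transpose A *v w) \<le> Max (singular_values A) * norm w"
    using lower[of w] upper[of w]
    by (auto simp: g_def intro: order_trans[OF mult_right_mono] order_trans[OF _ mult_right_mono])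
qed

text \<open>
  The bound for \<open>A\<^sup>T\<close> passes to \<open>A\<close> by duality: \<open>\<parallel>A x\<parallel>\<^sup>2 = \<langle>A\<^sup>T A x, x\<rangle>\<close>.
\<close>

lemma spectral_norm_le_Max: "spectral_norm A \<le> Max (singular_values A)"
  unfolding spectral_norm_def
proof (rule onorm_le)
  fix x
  have "(norm (A *v x))\<^sup>2 = (transpose A *v (A *v x)) \<bullet> x"
    unfolding power2_norm_eq_inner by (metis dot_lmul_matrix vector_transpose_matrix transpose_transpose)
  also have "\<dots> \<le> norm (transpose A *v (A *v x)) * norm x" by (rule norm_cauchy_schwarz)
  also have "\<dots> \<le> (Max (singular_values A) * norm (A *v x)) * norm x"
    by (intro mult_right_mono le_Max_singular_value) auto
  finally have "norm (A *v x) * norm (A *v x) \<le> norm (A *v x) * (Max (singular_values A) * norm x)"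
    by (simp add: power2_eq_square algebra_simps)
  moreover have "0 \<le> Max (singular_values A)"
    using Max_in[OF finite_singular_values singular_values_nonempty[of A]] by (simp add: singular_values_def)
  ultimately show "norm (A *v x) \<le> Max (singular_values A) * norm x"
    by (cases "A *v x = 0") auto
qed

text \<open>
  A vanishing singular value would give a nonzero \<open>v\<close> with \<open>\<parallel>A\<^sup>T v\<parallel>\<^sup>2 = \<langle>v, A A\<^sup>T v\<rangle> = 0\<close>, but
  \<open>A\<^sup>T\<close> is injective when \<open>A\<close> has full row rank.
\<close>

lemma Min_singular_value_pos:
  fixes A :: "real^'n^'m"
  assumes "rank A = CARD('m)"
  shows "0 < Min (singular_values A)"
proof -
  have "inj ((*v) (transpose A))"
    using assms by (metis full_rank_injective rank_transpose)
  have "0 \<notin> singular_values A"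
  proof
    assume "0 \<in> singular_values A"
    then obtain v where v: "v \<noteq> 0" "(A ** transpose A) *v v = 0"
      by (auto simp: singular_values_def)
    have "(transpose A *v v) \<bullet> (transpose A *v v) = v \<bullet> ((A ** transpose A) *v v)"
      by (metis dot_lmul_matrix matrix_vector_mul_assoc vector_transpose_matrix transpose_transpose)
    then have "transpose A *v v = transpose A *v 0" using v by simp
    then show False using \<open>inj _\<close> v by (metis injD)
  qed
  then show ?thesis
    using Min_in[OF finite_singular_values singular_values_nonempty[of A]]
    by (metis (no_types, lifting) mem_Collect_eq order_less_le singular_values_def)
qed

section \<open>Coordinates adapted to the row space\<close>

text \<open>
  The rows of \<open>Q\<close> form an orthonormal basis of the whole space, and those with index in \<open>I\<close> span \<open>V\<close>.
  Thus \<open>x \<mapsto> Q x\<close> are coordinates in which the projection onto \<open>V\<close> just keeps the entries in \<open>I\<close>.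
\<close>

lemma orthogonal_matrix_adapted_to_subspace:
  fixes V :: "(real^'n) set"
  assumes "subspace V"
  obtains Q :: "real^'n^'n" and I where "orthogonal_matrix Q" "card I = dim V"
    "\<And>y. (\<And>i. i \<notin> I \<Longrightarrow> y $ i = 0) \<Longrightarrow> transpose Q *v y \<in> V"
proof -
  define W where "W = {y \<in> UNIV. \<forall>x \<in> V. orthogonal x y}"
  have "subspace W" by (auto simp: W_def subspace_orthogonal_to_vectors)
  obtain B where B: "B \<subseteq> V" "pairwise orthogonal B" "\<And>x. x \<in> B \<Longrightarrow> norm x = 1"
    "independent B" "card B = dim V"
    using orthonormal_basis_subspace[OF assms] by metis
  obtain C where C: "C \<subseteq> W" "pairwise orthogonal C" "\<And>x. x \<in> C \<Longrightarrow> norm x = 1"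
    "independent C" "card C = dim W"
    using orthonormal_basis_subspace[OF \<open>subspace W\<close>] by metis
  have BC: "orthogonal x y" "orthogonal y x" if "x \<in> B" "y \<in> C" for x y
    using that B(1) C(1) by (auto simp: W_def subset_iff orthogonal_commute)
  have "B \<inter> C = {}"
  proof (intro equals0I)
    fix x assume "x \<in> B \<inter> C"
    then have "x = 0" "norm x = 1" using BC(1)[of x x] B(3)[of x] by (auto simp: orthogonal_self)
    then show False by simp
  qed
  moreover have "finite B" "finite C" using B(4) C(4) by (simp_all add: independent_imp_finite)
  ultimately have "card (B \<union> C) = CARD('n)"
    using dim_subspace_orthogonal_to_vectors[OF assms subspace_UNIV] B(5) C(5)
    by (simp add: card_Un_disjoint W_def)
  then obtain q :: "'n \<Rightarrow> real^'n" where q: "bij_betw q UNIV (B \<union> C)"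
    using finite_same_card_bij[of "UNIV :: 'n set" "B \<union> C"] \<open>finite B\<close> \<open>finite C\<close> by auto
  define Q :: "real^'n^'n" where "Q = (\<chi> i. q i)"
  have row: "row i Q = q i" for i by (simp add: Q_def row_def vec_eq_iff)
  define I where "I = {i. q i \<in> B}"
  have qBC: "q i \<in> B \<union> C" for i using q by (auto simp: bij_betw_def)
  have inj: "q i = q j \<longleftrightarrow> i = j" for i j using q by (auto simp: bij_betw_def inj_on_def)
  show thesis
  proof
    show "orthogonal_matrix Q"
      unfolding orthogonal_matrix_orthonormal_rows row
    proof (intro conjI allI impI)
      show "norm (q i) = 1" for i using qBC[of i] B(3) C(3) by auto
      show "orthogonal (q i) (q j)" if "i \<noteq> j" for i j
        using qBC[of i] qBC[of j] B(2) C(2) BC inj[of i j] that by (auto simp: pairwise_def)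
    qed
    have "q ` I = B" using q by (auto simp: I_def bij_betw_def)
    moreover have "inj_on q I" using inj by (auto simp: inj_on_def)
    ultimately show "card I = dim V" using B(5) card_image by metis
    show "transpose Q *v y \<in> V" if y: "\<And>i. i \<notin> I \<Longrightarrow> y $ i = 0" for y
    proof -
      have "transpose Q *v y = (\<Sum>i\<in>UNIV. y $ i *\<^sub>R q i)"
        by (simp add: matrix_mult_sum column_transpose row scalar_mult_eq_scaleR)
      also have "\<dots> \<in> V"
      proof (rule subspace_sum[OF assms])
        show "y $ i *\<^sub>R q i \<in> V" for i
          using y[of i] B(1) assms by (cases "i \<in> I") (auto simp: I_def subspace_0 subspace_scale)
      qed
      finally show ?thesis .
    qed
  qed
qed

text \<open>
  The sum on the left is \<open>\<parallel>p\<parallel>\<^sup>2\<close> for the projection \<open>p = A\<^sup>T w\<close> of \<open>x\<close> onto the row space. The claim follows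
  from \<open>\<parallel>p\<parallel>\<^sup>2 = \<langle>p, x\<rangle> = \<langle>w, A x\<rangle> \<le> \<parallel>w\<parallel> \<parallel>A x\<parallel>\<close> and \<open>s \<parallel>w\<parallel> \<le> \<parallel>p\<parallel>\<close>.
\<close>

lemma norm_lower_bound_on_row_space:
  fixes A :: "real^'n^'m" and Q :: "real^'n^'n"
  assumes Q: "orthogonal_matrix Q" and s: "0 \<le> s"
    and rows: "\<And>y. (\<And>i. i \<notin> I \<Longrightarrow> y $ i = 0) \<Longrightarrow> transpose Q *v y \<in> range ((*v) (transpose A))"
    and le: "\<And>w. s * norm w \<le> norm (transpose A *v w)"
  shows "s\<^sup>2 * (\<Sum>i\<in>I. ((Q *v x) $ i)\<^sup>2) \<le> (norm (A *v x))\<^sup>2"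
proof -
  define y where "y = (\<chi> i. if i \<in> I then (Q *v x) $ i else 0)"
  define p where "p = transpose Q *v y"
  obtain w where w: "p = transpose A *v w" using rows[of y] by (auto simp: p_def y_def)
  have yQ: "y \<bullet> (Q *v x) = (\<Sum>i\<in>I. ((Q *v x) $ i)\<^sup>2)" "y \<bullet> y = (\<Sum>i\<in>I. ((Q *v x) $ i)\<^sup>2)"
    by (auto simp: inner_vec_def y_def power2_eq_square if_distrib if_distribR sum.If_cases cong: if_cong)
  have px: "p \<bullet> x = y \<bullet> (Q *v x)"
    by (metis p_def dot_lmul_matrix vector_transpose_matrix transpose_transpose)
  have "orthogonal_transformation ((*v) (transpose Q))"
    using Q by (simp add: orthogonal_matrix_transpose orthogonal_transformation_matrix)
  then have pp: "p \<bullet> p = y \<bullet> y" by (simp add: p_def orthogonal_transformation_def)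
  have "(s * norm p) * norm p = s * (w \<bullet> (A *v x))"
    using px pp yQ w by (metis (no_types) dot_lmul_matrix vector_transpose_matrix transpose_transpose
        mult.assoc power2_eq_square power2_norm_eq_inner)
  also have "\<dots> \<le> s * (norm w * norm (A *v x))"
    using s by (intro mult_left_mono norm_cauchy_schwarz)
  also have "\<dots> \<le> norm p * norm (A *v x)"
    using le[of w] w by (simp add: mult_right_mono flip: mult.assoc)
  finally have "s * norm p \<le> norm (A *v x)"
    by (cases "p = 0") (auto simp: mult.commute)
  then have "(s * norm p)\<^sup>2 \<le> (norm (A *v x))\<^sup>2"
    using s by (intro power_mono) auto
  then show ?thesis
    using pp yQ by (simp add: power_mult_distrib power2_norm_eq_inner)
qed

section \<open>The volume of a cone around a subspace\<close>

text \<open>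
  An orthogonal transformation maps balls to balls of the same radius. By Vitali's covering theorem
  a box is, up to a null set, a countable disjoint union of balls, so its volume is preserved;
  volumes of boxes determine the effect of a linear map on all measurable sets.
\<close>

lemma measure_image_orthogonal_transformation:
  fixes f :: "'a::euclidean_space \<Rightarrow> 'a"
  assumes f: "orthogonal_transformation f" and S: "S \<in> lmeasurable"
  shows "f ` S \<in> lmeasurable" and "measure lebesgue (f ` S) = measure lebesgue S"
proof -
  have lin: "linear f" and inj: "inj f"
    using f orthogonal_transformation_linear orthogonal_transformation_inj by auto
  have cb: "f ` cball x r = cball (f x) r" for x r
    by (rule image_orthogonal_transformation_cball[OF f])
  have "measure lebesgue (f ` cbox a b) = 1 * measure lebesgue (cbox a b)" for a b
  proof -
    define K where "K = {i :: 'a \<times> real. 0 < snd i \<and> cball (fst i) (snd i) \<subseteq> cbox a b}"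
    obtain C where C: "countable C" "C \<subseteq> K"
      "pairwise (\<lambda>i j. disjnt (cball (fst i) (snd i)) (cball (fst j) (snd j))) C"
      "negligible (box a b - (\<Union>i\<in>C. cball (fst i) (snd i)))"
    proof (rule Vitali_covering_theorem_cballs[of K snd "box a b" fst])
      show "0 < snd i" if "i \<in> K" for i using that by (auto simp: K_def)
      show "\<exists>i. i \<in> K \<and> x \<in> cball (fst i) (snd i) \<and> snd i < d" if "x \<in> box a b" "0 < d" for x d
      proof -
        obtain e where e: "0 < e" "cball x e \<subseteq> box a b"
          using open_box \<open>x \<in> box a b\<close> open_contains_cball by metis
        then have "cball x (min e (d/2)) \<subseteq> cbox a b"
          using box_subset_cbox[of a b] by (auto simp: subset_iff)
        then show ?thesis
          using e that by (intro exI[of _ "(x, min e (d/2))"]) (auto simp: K_def)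
      qed
    qed
    define U where "U = (\<Union>i\<in>C. cball (fst i) (snd i))"
    have disj: "disjoint_family_on (\<lambda>i. cball (fst i) (snd i)) C"
      using C(3) by (auto simp: disjoint_family_on_def pairwise_def disjnt_def)
    then have disj': "disjoint_family_on (\<lambda>i. f ` cball (fst i) (snd i)) C"
      using inj unfolding disjoint_family_on_def by (metis image_Int image_empty)
    have U: "U \<subseteq> cbox a b" using C(2) unfolding U_def K_def by blast
    have "negligible ((box a b - U) \<union> (cbox a b - box a b))"
      using C(4) by (intro negligible_Un) (auto simp: U_def negligible_frontier_interval)
    then have neg: "negligible (cbox a b - U)" by (rule negligible_subset) auto
    then have negf: "negligible (f ` (cbox a b - U))"
      using negligible_differentiable_image_negligible linear_imp_differentiable_on[OF lin] by blast
    have Um: "U \<in> lmeasurable"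
      by (rule lmeasurable_negligible_symdiff[OF lmeasurable_cbox[of a b]])
         (use neg U in \<open>simp add: Diff_eq_empty_iff[THEN iffD2]\<close>)
    have "f ` cbox a b - f ` U = f ` (cbox a b - U)" using inj by (simp add: image_set_diff)
    then have sd: "negligible (f ` cbox a b - f ` U \<union> (f ` U - f ` cbox a b))"
      using negf U by (simp add: Diff_eq_empty_iff[THEN iffD2] image_mono)
    have "emeasure lebesgue (f ` U) = (\<integral>\<^sup>+i. emeasure lebesgue (f ` cball (fst i) (snd i)) \<partial>count_space C)"
      unfolding U_def image_UN by (intro emeasure_UN_countable disj' C) (simp add: cb)
    also have "\<dots> = (\<integral>\<^sup>+i. emeasure lebesgue (cball (fst i) (snd i)) \<partial>count_space C)"
      using C(2) by (intro nn_integral_cong) (auto simp: cb K_def emeasure_cball)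
    also have "\<dots> = emeasure lebesgue U"
      unfolding U_def by (intro emeasure_UN_countable[symmetric] disj C) simp
    finally have "measure lebesgue (f ` U) = measure lebesgue U" by (simp add: measure_def)
    moreover have "measure lebesgue (f ` U) = measure lebesgue (f ` cbox a b)"
      using measure_negligible_symdiff[OF measurable_linear_image_interval[OF lin] sd] .
    moreover have "measure lebesgue U = measure lebesgue (cbox a b)"
      using neg U by (intro measure_negligible_symdiff) (auto simp: Diff_eq_empty_iff[THEN iffD2])
    ultimately show ?thesis by simp
  qed
  from measure_linear_sufficient[OF lin S this]
  show "f ` S \<in> lmeasurable" and "measure lebesgue (f ` S) = measure lebesgue S" by auto
qed

text \<open>
  After rotating by \<open>Q\<close>, the coordinates in \<open>I\<close> are stretched by \<open>a\<close> and the others compressed by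
  \<open>b\<close>. The equation between \<open>a\<close>, \<open>b\<close> and \<open>t\<close> says that vectors on the boundary of the cone keep their
  length; the other vectors of the cone do not get longer because \<open>b \<le> a\<close>.
\<close>

lemma volume_cone_near_complement_le:
  fixes Q :: "real^'n^'n" and C :: "(real^'n) set"
  assumes Q: "orthogonal_matrix Q" and C: "C \<in> lmeasurable"
    and ab: "0 \<le> b" "b \<le> a" "a\<^sup>2 * t + b\<^sup>2 * (1 - t) = 1"
    and cone: "\<And>x. x \<in> C \<Longrightarrow> (\<Sum>i\<in>I. ((Q *v x) $ i)\<^sup>2) \<le> t * (norm x)\<^sup>2"
    and R: "\<And>x. x \<in> C \<Longrightarrow> norm x \<le> R"
  shows "a ^ card I * b ^ card (- I) * measure lebesgue C \<le> measure lebesgue (cball (0 :: real^'n) R)"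
proof -
  define d where "d i = (if i \<in> I then a else b)" for i
  define T where "T z = (\<chi> i. d i * z $ i)" for z :: "real^'n"
  have orth: "orthogonal_transformation ((*v) Q)"
    using Q by (simp add: orthogonal_transformation_matrix)
  have QC: "(*v) Q ` C \<in> lmeasurable"
    and Qvol: "measure lebesgue ((*v) Q ` C) = measure lebesgue C"
    by (rule measure_image_orthogonal_transformation[OF orth C])+
  have "(\<Prod>i\<in>UNIV. d i) = a ^ card I * b ^ card (- I)"
    by (simp add: d_def prod.If_cases)
  moreover have "T ` (*v) Q ` C \<in> lmeasurable"
    and "measure lebesgue (T ` (*v) Q ` C) = \<bar>\<Prod>i\<in>UNIV. d i\<bar> * measure lebesgue ((*v) Q ` C)"
    unfolding T_def by (rule measurable_stretch[OF QC], rule measure_stretch[OF QC])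
  ultimately have TQC: "T ` (*v) Q ` C \<in> lmeasurable"
    and vol: "measure lebesgue (T ` (*v) Q ` C) = a ^ card I * b ^ card (- I) * measure lebesgue C"
    using ab by (auto simp: Qvol abs_mult)
  have inball: "T ` (*v) Q ` C \<subseteq> cball 0 R"
  proof clarify
    fix x assume x: "x \<in> C"
    define z where "z = Q *v x"
    have "norm z = norm x"
      using orth unfolding z_def by (simp add: orthogonal_transformation)
    moreover have "(norm z)\<^sup>2 = (\<Sum>i\<in>UNIV. (z $ i)\<^sup>2)"
      unfolding power2_norm_eq_inner by (simp add: inner_vec_def power2_eq_square)
    ultimately have zx: "(\<Sum>i\<in>UNIV. (z $ i)\<^sup>2) = (norm x)\<^sup>2" by simp
    have "(norm (T z))\<^sup>2 = (\<Sum>i\<in>UNIV. (d i * z $ i)\<^sup>2)"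
      unfolding power2_norm_eq_inner by (simp add: T_def inner_vec_def power2_eq_square)
    also have "\<dots> = (\<Sum>i\<in>UNIV. b\<^sup>2 * (z $ i)\<^sup>2 + (if i \<in> I then (a\<^sup>2 - b\<^sup>2) * (z $ i)\<^sup>2 else 0))"
      by (intro sum.cong) (auto simp: d_def power_mult_distrib algebra_simps)
    also have "\<dots> = b\<^sup>2 * (norm x)\<^sup>2 + (a\<^sup>2 - b\<^sup>2) * (\<Sum>i\<in>I. (z $ i)\<^sup>2)"
      by (simp add: sum.distrib sum.If_cases zx flip: sum_distrib_left)
    also have "\<dots> \<le> b\<^sup>2 * (norm x)\<^sup>2 + (a\<^sup>2 - b\<^sup>2) * (t * (norm x)\<^sup>2)"
      using ab cone[OF x] by (intro add_left_mono mult_left_mono) (auto simp: z_def power_mono)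
    also have "\<dots> = (a\<^sup>2 * t + b\<^sup>2 * (1 - t)) * (norm x)\<^sup>2" by (simp add: algebra_simps)
    also have "\<dots> = (norm x)\<^sup>2" using ab by simp
    finally have "norm (T z) \<le> norm x" by (rule power2_le_imp_le) simp
    then show "T (Q *v x) \<in> cball 0 R"
      using R[OF x] by (simp add: z_def)
  qed
  show ?thesis
    using measure_mono_fmeasurable[OF inball _ lmeasurable_cball] TQC vol by (simp add: fmeasurableD)
qed

text \<open>
  With \<open>u = (\<xi>\<^sup>2 - t\<^sup>2) / (1 - \<xi>\<^sup>2)\<close> one has \<open>1 / b\<^sup>2 = 1 + u \<le> exp u\<close>. As \<open>m = n \<xi>\<^sup>2\<close>, the
  exponent \<open>(n - m) u / 2\<close> equals \<open>m (1 - (t / \<xi>)\<^sup>2) / 2\<close>, the one in \<open>phi (t / \<xi>) ^ m\<close>.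
\<close>

lemma reciprocal_stretch_le_phi_power:
  fixes t \<xi> :: real
  assumes "0 < t" "t < \<xi>" "m < n" "\<xi>\<^sup>2 = real m / real n"
    and b: "b = sqrt ((1 - \<xi>\<^sup>2) / (1 - t\<^sup>2))"
  shows "1 / ((\<xi> / t) ^ m * b ^ (n - m)) \<le> phi (t / \<xi>) ^ m"
proof -
  have n: "real n > 0" using assms by simp
  have m: "real m = n * \<xi>\<^sup>2" using assms by simp
  have xi1: "\<xi>\<^sup>2 < 1" unfolding assms(4) using assms(3) by simp
  have tx: "t\<^sup>2 < \<xi>\<^sup>2" using assms by (intro power_strict_mono) auto
  define u where "u = (\<xi>\<^sup>2 - t\<^sup>2) / (1 - \<xi>\<^sup>2)"
  have b0: "b > 0" using xi1 tx by (simp add: b)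
  have "(1 / b)\<^sup>2 = 1 + u"
    using xi1 tx by (simp add: b u_def power_divide real_sqrt_divide divide_simps)
  also have "\<dots> \<le> exp u" by (rule exp_ge_add_one_self)
  also have "\<dots> = (exp (u / 2))\<^sup>2" by (simp flip: exp_double)
  finally have "1 / b \<le> exp (u / 2)" by (rule power2_le_imp_le) simp
  then have "(1 / b) ^ (n - m) \<le> exp (u / 2) ^ (n - m)"
    using b0 by (intro power_mono) auto
  also have "\<dots> = exp (real (n - m) * (u / 2))" by (simp only: exp_of_nat_mult)
  also have "real (n - m) * (u / 2) = real m * ((1 - (t / \<xi>)\<^sup>2) / 2)"
  proof -
    have "real (n - m) = n * (1 - \<xi>\<^sup>2)" using assms m by (simp add: of_nat_diff algebra_simps)
    then have "real (n - m) * u = n * (\<xi>\<^sup>2 - t\<^sup>2)" using xi1 by (simp add: u_def)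
    also have "\<dots> = real m * (1 - (t / \<xi>)\<^sup>2)"
      using assms by (simp add: m power_divide algebra_simps)
    finally show ?thesis by simp
  qed
  finally have "(t / \<xi>) ^ m * (1 / b) ^ (n - m) \<le> (t / \<xi>) ^ m * exp ((1 - (t / \<xi>)\<^sup>2) / 2) ^ m"
    using assms by (intro mult_left_mono) (simp_all only: exp_of_nat_mult, simp_all)
  then show ?thesis
    by (simp add: phi_def power_mult_distrib power_divide)
qed

theorem theorem4p4:
  fixes A :: "real^'n^'m" and \<kappa> \<xi> \<delta> R :: real
  assumes "CARD('m) < CARD('n)"
    and "rank A = CARD('m)"
    and "\<kappa> = condition_number A"
    and "\<xi> = sqrt (real CARD('m) / real CARD('n))"
    and "\<delta> \<ge> 0"
    and "\<kappa> * \<delta> < \<xi>"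
    and "R > 0"
  shows "measure lebesgue {x :: real^'n. norm (A *v x) < \<delta> * spectral_norm A * norm x \<and> norm x \<le> R}
           / measure lebesgue {x :: real^'n. norm x \<le> R}
         \<le> phi (\<kappa> * \<delta> / \<xi>) ^ CARD('m)"
proof (cases "\<delta> = 0")
  case True
  \<comment> \<open>The stretching factor \<open>\<xi> / t\<close> would be infinite here, but the set in the numerator is empty.\<close>
  then show ?thesis by (simp add: phi_def)
next
  case False
  define \<sigma>\<^sub>1 \<sigma>\<^sub>m t where "\<sigma>\<^sub>1 = Min (singular_values A)" "\<sigma>\<^sub>m = Max (singular_values A)" "t = \<kappa> * \<delta>"
  note defs = this
  define C where "C = {x :: real^'n. norm (A *v x) < \<delta> * spectral_norm A * norm x \<and> norm x \<le> R}"
  define b where "b = sqrt ((1 - \<xi>\<^sup>2) / (1 - t\<^sup>2))"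
  have \<sigma>1: "0 < \<sigma>\<^sub>1" using Min_singular_value_pos assms(2) defs by simp
  have "\<sigma>\<^sub>1 \<le> \<sigma>\<^sub>m"
    using Min_le[OF finite_singular_values Max_in[OF finite_singular_values singular_values_nonempty[of A]]]
    by (simp add: defs)
  then have t: "0 < t" "\<sigma>\<^sub>1 * t = \<sigma>\<^sub>m * \<delta>"
    using \<sigma>1 False assms(3,5) by (auto simp: defs condition_number_def)
  have tx: "t < \<xi>" using assms(6) defs by simp
  have \<xi>2: "\<xi>\<^sup>2 = real CARD('m) / real CARD('n)" using assms(4) by simp
  have xi1: "\<xi>\<^sup>2 < 1" using \<xi>2 assms(1) by simp
  have tx2: "t\<^sup>2 < \<xi>\<^sup>2" using t tx by (intro power_strict_mono) auto
  have b2: "b\<^sup>2 = (1 - \<xi>\<^sup>2) / (1 - t\<^sup>2)" using xi1 tx2 by (simp add: b_def)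
  have b0: "b > 0" using xi1 tx2 by (simp add: b_def)
  have ball: "{x :: real^'n. norm x \<le> R} = cball 0 R" by auto
  have "open {x. norm (A *v x) < \<delta> * spectral_norm A * norm x}"
    by (intro open_Collect_less continuous_intros matrix_vector_mult_linear_continuous_on)
  moreover have "C = {x. norm (A *v x) < \<delta> * spectral_norm A * norm x} \<inter> cball 0 R"
    by (auto simp: C_def)
  ultimately have "C \<in> sets borel" by simp
  moreover have "bounded C" by (rule bounded_subset[of "cball 0 R"]) (auto simp: C_def)
  ultimately have "C \<in> lmeasurable" by (simp add: bounded_set_imp_lmeasurable)
  obtain Q :: "real^'n^'n" and I where Q: "orthogonal_matrix Q"
    "card I = dim (range ((*v) (transpose A)))"
    "\<And>y. (\<And>i. i \<notin> I \<Longrightarrow> y $ i = 0) \<Longrightarrow> transpose Q *v y \<in> range ((*v) (transpose A))"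
    using orthogonal_matrix_adapted_to_subspace[of "range ((*v) (transpose A))"]
    by (metis linear_subspace_image matrix_vector_mul_linear subspace_UNIV)
  have I: "card I = CARD('m)" using Q(2) assms(2) by (metis rank_dim_range rank_transpose)
  then have I': "card (- I) = CARD('n) - CARD('m)" by (simp add: Compl_eq_Diff_UNIV card_Diff_subset)
  have "(\<xi> / t) ^ card I * b ^ card (- I) * measure lebesgue C \<le> measure lebesgue (cball (0 :: real^'n) R)"
  proof (rule volume_cone_near_complement_le[OF Q(1) \<open>C \<in> lmeasurable\<close>, where t = "t\<^sup>2"])
    show "0 \<le> b" using b0 by simp
    have "b \<le> 1" using xi1 tx2 by (simp add: b_def)
    also have "1 \<le> \<xi> / t" using t tx by simp
    finally show "b \<le> \<xi> / t" .
    show "(\<xi> / t)\<^sup>2 * t\<^sup>2 + b\<^sup>2 * (1 - t\<^sup>2) = 1"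
      using t xi1 tx2 by (simp add: b2 power_divide)
    fix x assume x: "x \<in> C"
    then show "norm x \<le> R" by (simp add: C_def)
    have "norm (A *v x) \<le> \<delta> * spectral_norm A * norm x" using x by (simp add: C_def)
    also have "\<dots> \<le> \<delta> * \<sigma>\<^sub>m * norm x"
      using assms(5) spectral_norm_le_Max[of A] by (intro mult_right_mono mult_left_mono) (auto simp: defs)
    also have "\<dots> = \<sigma>\<^sub>1 * t * norm x" using t(2) by (simp add: mult.commute)
    finally have "(norm (A *v x))\<^sup>2 \<le> (\<sigma>\<^sub>1 * t * norm x)\<^sup>2" by (intro power_mono) auto
    moreover have "\<sigma>\<^sub>1\<^sup>2 * (\<Sum>i\<in>I. ((Q *v x) $ i)\<^sup>2) \<le> (norm (A *v x))\<^sup>2"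
      using \<sigma>1 Q Min_singular_value_le
      by (intro norm_lower_bound_on_row_space) (auto simp: defs)
    ultimately have "\<sigma>\<^sub>1\<^sup>2 * (\<Sum>i\<in>I. ((Q *v x) $ i)\<^sup>2) \<le> \<sigma>\<^sub>1\<^sup>2 * (t\<^sup>2 * (norm x)\<^sup>2)"
      by (simp add: power_mult_distrib mult.assoc)
    then show "(\<Sum>i\<in>I. ((Q *v x) $ i)\<^sup>2) \<le> t\<^sup>2 * (norm x)\<^sup>2" using \<sigma>1 by simp
  qed
  moreover have "0 < measure lebesgue (cball (0 :: real^'n) R)"
    using assms(7) by (simp add: content_cball_pos)
  moreover have "0 < (\<xi> / t) ^ card I * b ^ card (- I)" using t tx b0 by simp
  moreover have "v / w \<le> 1 / k" if "k * v \<le> w" "0 < w" "0 < k" for v w k :: real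
    using that by (simp add: field_simps)
  ultimately have "measure lebesgue C / measure lebesgue (cball (0 :: real^'n) R)
      \<le> 1 / ((\<xi> / t) ^ card I * b ^ card (- I))"
    by blast
  also have "\<dots> \<le> phi (t / \<xi>) ^ CARD('m)"
    using reciprocal_stretch_le_phi_power[OF t(1) tx assms(1) \<xi>2 b_def] by (simp add: I I')
  finally show ?thesis by (simp add: C_def ball defs)
qed

end
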